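(* For every integer $n\ge0$ and every nonnegative integer $r$, as polynomials in $x$, \[ \sum_{k=0}^{n}S_{2,\lambda}^{(r,Y)}(n+r,k+r)(x)_{k}=\sum_{k=0}^{n}S_{2,\lambda}^{Y}(n,k)(x+r)_{k}, \] where $(x)_0=1$ and $(x)_k=x(x-1)\cdots(x-k+1)$ for $k\ge1$.
   Context: Let $\lambda$ be a nonzero real number. Define $(x)_{0,\lambda}=1$ and $(x)_{n,\lambda}=x(x-\lambda)\cdots(x-(n-1)\lambda)$ for $n\ge1$, and the degenerate exponential $e_{\lambda}^{x}(t)=(1+\lambda t)^{x/\lambda}=\sum_{n\ge0}(x)_{n,\lambda}\frac{t^n}{n!}$. Let $Y$ be a random variable whose moment generating function exists in a neighborhood of the origin, let $(Y_j)_{j\ge1}$ be mutually independent copies of $Y$, and set $S_0=0$, $S_k=Y_1+\cdots+Y_k$ for $k\ge1$. The probabilistic degenerate Stirling numbers of the second kind associated with $Y$ are defined by $\frac{1}{k!}\big(E[e_{\lambda}^{Y}(t)]-1\big)^{k}=\sum_{n=k}^{\infty}S_{2,\lambda}^{Y}(n,k)\frac{t^n}{n!}$. For $r$ a nonnegative integer, the probabilistic degenerate $r$-Stirling numbers of the second kind associated with $Y$ are defined by \[ \frac{1}{k!}\Big(E\big[e_{\lambda}^{Y}(t)\big]-1\Big)^{k}E\big[e_{\lambda}^{S_r}(t)\big]=\sum_{n=k}^{\infty}S_{2,\lambda}^{(r,Y)}(n+r,k+r)\frac{t^n}{n!},\quad(k\ge0). \] *)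

theory Defs
  imports "HOL-Probability.Probability" "HOL-Computational_Algebra.Polynomial"
begin

definition falling_fact :: "'a::comm_ring_1 \<Rightarrow> nat \<Rightarrow> 'a" where
  "falling_fact x k = (\<Prod>i<k. x - of_nat i)"

text \<open>The base is positive, so \<open>powr\<close> is the usual real power, for all \<open>t\<close> near \<open>0\<close>;
  only such \<open>t\<close> matter below.\<close>

definition deg_exp :: "real \<Rightarrow> real \<Rightarrow> real \<Rightarrow> real" where
  "deg_exp lam x t = (1 + lam * t) powr (x / lam)"

definition has_mgf_near_0 :: "'a measure \<Rightarrow> ('a \<Rightarrow> real) \<Rightarrow> bool" where
  "has_mgf_near_0 M Y \<longleftrightarrow>
     (\<exists>\<epsilon>>0. \<forall>t. \<bar>t\<bar> < \<epsilon> \<longrightarrow> integrable M (\<lambda>\<omega>. exp (t * Y \<omega>)))"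

definition iid_copies :: "'a measure \<Rightarrow> ('a \<Rightarrow> real) \<Rightarrow> (nat \<Rightarrow> 'a \<Rightarrow> real) \<Rightarrow> bool" where
  "iid_copies M Y Ys \<longleftrightarrow>
     prob_space.indep_vars M (\<lambda>_. borel) Ys {1..} \<and>
     (\<forall>j\<ge>1. distr M borel (Ys j) = distr M borel Y)"

definition partial_sum :: "(nat \<Rightarrow> 'a \<Rightarrow> real) \<Rightarrow> nat \<Rightarrow> 'a \<Rightarrow> real" where
  "partial_sum Ys k \<omega> = (\<Sum>j=1..k. Ys j \<omega>)"

text \<open>\<open>egf_coeffs k F\<close> is the sequence \<open>a\<close>, extended by zero below \<open>k\<close>, for which \<open>F t\<close> is the
  sum over \<open>n \<ge> k\<close> of \<open>a n * t ^ n / n!\<close> for all \<open>t\<close> in a neighbourhood of \<open>0\<close>.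
  It is unique whenever it exists, by the identity theorem for power series.\<close>

definition egf_coeffs :: "nat \<Rightarrow> (real \<Rightarrow> real) \<Rightarrow> nat \<Rightarrow> real" where
  "egf_coeffs k F = (THE a. (\<forall>n<k. a n = 0) \<and>
     (\<forall>\<^sub>F t in nhds 0. (\<lambda>n. a n * t ^ n / fact n) sums F t))"

definition prob_deg_Stirling2 ::
  "'a measure \<Rightarrow> ('a \<Rightarrow> real) \<Rightarrow> real \<Rightarrow> nat \<Rightarrow> nat \<Rightarrow> real" where
  "prob_deg_Stirling2 M Y lam n k =
     egf_coeffs k (\<lambda>t. 1 / fact k * ((\<integral>\<omega>. deg_exp lam (Y \<omega>) t \<partial>M) - 1) ^ k) n"

text \<open>The arguments \<open>n\<close> and \<open>k\<close> are the shifted indices of the \<open>r\<close>-Stirling numbers, so the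
  definition is meaningful for \<open>n \<ge> r\<close> and \<open>k \<ge> r\<close> only.\<close>

definition prob_deg_r_Stirling2 ::
  "'a measure \<Rightarrow> ('a \<Rightarrow> real) \<Rightarrow> (nat \<Rightarrow> 'a \<Rightarrow> real) \<Rightarrow> real \<Rightarrow> nat \<Rightarrow> nat \<Rightarrow> nat \<Rightarrow> real" where
  "prob_deg_r_Stirling2 M Y Ys lam r n k =
     egf_coeffs (k - r)
       (\<lambda>t. 1 / fact (k - r) * ((\<integral>\<omega>. deg_exp lam (Y \<omega>) t \<partial>M) - 1) ^ (k - r) *
            (\<integral>\<omega>. deg_exp lam (partial_sum Ys r \<omega>) t \<partial>M))
       (n - r)"

end

theory Submission
  imports Defs "HOL-Complex_Analysis.Cauchy_Integral_Formula"
begin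

text \<open>Let \<open>G t = E[deg_exp lam Y t]\<close>. Integrating the binomial series termwise shows that \<open>G\<close> has
  a power series expansion \<open>1 + A\<close> at \<open>0\<close> with \<open>A\<close> lacking a constant term, and independence gives
  \<open>E[deg_exp lam (S r) t] = G t ^ r\<close>. So the two families of Stirling numbers are \<open>n!\<close> times the
  coefficients of \<open>A ^ k / k!\<close> and \<open>A ^ k * (1 + A) ^ r / k!\<close>. At \<open>x = m\<close>, a natural number, both
  sides of the claim become \<open>n!\<close> times the \<open>n\<close>-th coefficient of \<open>(1 + A) ^ (m + r)\<close>, and
  polynomials that agree at all natural numbers are equal.\<close>

section \<open>Power series expansions and uniqueness of their coefficients\<close>

text \<open>A nonzero coefficient would make the zero at the origin isolated, but the sum vanishes
  on a whole neighbourhood.\<close>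

lemma powser_eq_0_imp_coeffs_0:
  fixes a :: "nat \<Rightarrow> 'a::{real_normed_field, banach}"
  assumes "\<forall>\<^sub>F t in nhds 0. (\<lambda>n. a n * t ^ n) sums 0"
  shows "a m = 0"
proof (rule ccontr)
  assume m: "a m \<noteq> 0"
  obtain r where r: "r > 0" "\<And>t. norm t < r \<Longrightarrow> (\<lambda>n. a n * t ^ n) sums 0"
    using assms unfolding eventually_nhds_metric by (auto simp: dist_norm)
  \<comment> \<open>\<open>powser_0_nonzero\<close> needs a nonzero coefficient of positive index,
    so index 0 is excluded first by evaluating at \<open>t = 0\<close>.\<close>
  have "a 0 = 0"
    using r(2)[of 0] r(1) by simp
  with m have "m > 0"
    by (cases m) auto
  show False
  proof (rule powser_0_nonzero[of r 0 a "\<lambda>_. 0" m])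
    fix s :: real
    assume "0 < s" and "\<And>z. z \<in> cball (0::'a) s - {0} \<Longrightarrow> (0::'a) \<noteq> 0"
    from this(2)[of "of_real s"] this(1) show False
      by simp
  qed (use r m \<open>m > 0\<close> in auto)
qed

text \<open>Resolves the definite description: convergence of \<open>F\<close> near the origin gives
  existence, the identity theorem above gives uniqueness. Both kinds of Stirling numbers are
  computed through this lemma.\<close>

lemma egf_coeffs_eq:
  assumes F: "f has_fps_expansion F" and low: "\<And>n. n < k \<Longrightarrow> fps_nth F n = 0"
  shows "egf_coeffs k f n = fact n * fps_nth F n"
proof -
  let ?P = "\<lambda>a::nat \<Rightarrow> real. (\<forall>n<k. a n = 0) \<and>
              (\<forall>\<^sub>F t in nhds 0. (\<lambda>n. a n * t ^ n / fact n) sums f t)"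
  have "\<forall>\<^sub>F t in nhds 0. t \<in> eball 0 (fps_conv_radius F)"
    using F by (intro eventually_nhds_in_open) (auto simp: has_fps_expansion_def zero_ereal_def)
  moreover have "\<forall>\<^sub>F t in nhds 0. eval_fps F t = f t"
    using F by (simp add: has_fps_expansion_def)
  ultimately have ev: "\<forall>\<^sub>F t in nhds 0. (\<lambda>n. fps_nth F n * t ^ n) sums f t"
    by eventually_elim (use sums_eval_fps[of _ F] in force)
  have "egf_coeffs k f = (\<lambda>n. fact n * fps_nth F n)"
    unfolding egf_coeffs_def
  proof (rule the_equality)
    show "?P (\<lambda>n. fact n * fps_nth F n)"
      using low ev by auto
  next
    fix a assume a: "?P a"
    have "\<forall>\<^sub>F t in nhds 0. (\<lambda>n. (a n / fact n - fps_nth F n) * t ^ n) sums 0"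
      using a[THEN conjunct2] ev
    proof eventually_elim
      case (elim t)
      show ?case
        using sums_diff[OF elim] by (simp add: algebra_simps)
    qed
    then have "a n / fact n - fps_nth F n = 0" for n
      by (rule powser_eq_0_imp_coeffs_0)
    then show "a = (\<lambda>n. fact n * fps_nth F n)"
      by (auto simp: fun_eq_iff field_simps)
  qed
  then show ?thesis by simp
qed

lemma has_fps_expansion_power:
  fixes F :: "'a::{banach, real_normed_div_algebra, comm_ring_1} fps"
  assumes "f has_fps_expansion F"
  shows "(\<lambda>t. f t ^ k) has_fps_expansion F ^ k"
  by (induction k) (auto intro: has_fps_expansion_mult assms)

section \<open>Expectation of the degenerate exponential near the origin\<close>

text \<open>Factorwise triangle inequality. The bound is the rising factorial of
  \<open>\<bar>a\<bar>\<close> over \<open>fact n\<close>, the coefficient of \<open>u ^ n\<close>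
  in \<open>(1 - u) powr (- \<bar>a\<bar>)\<close>.\<close>

lemma abs_gbinomial_le:
  fixes a :: real
  shows "\<bar>a gchoose n\<bar> \<le> (- 1) ^ n * ((- \<bar>a\<bar>) gchoose n)"
proof -
  have "\<bar>a gchoose n\<bar> = (\<Prod>i=0..<n. \<bar>a - of_nat i\<bar>) / fact n"
    by (simp add: gbinomial_prod_rev abs_prod)
  also have "\<dots> \<le> (\<Prod>i=0..<n. \<bar>a\<bar> + of_nat i) / fact n"
    by (intro divide_right_mono prod_mono) auto
  also have "\<dots> = (- 1) ^ n * ((- \<bar>a\<bar>) gchoose n)"
    by (simp add: gbinomial_pochhammer pochhammer_prod)
  finally show ?thesis .
qed

text \<open>The majorant does not depend on \<open>N\<close>; with
  \<open>a = Y \<omega> / lam\<close> it becomes the dominating function for termwise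
  integration.\<close>

lemma sum_abs_gbinomial_le:
  fixes a u :: real
  assumes "0 \<le> u" "u < 1"
  shows "summable (\<lambda>n. \<bar>a gchoose n\<bar> * u ^ n)"
    and "(\<Sum>n<N. \<bar>a gchoose n\<bar> * u ^ n) \<le> (1 - u) powr (- \<bar>a\<bar>)"
proof -
  let ?g = "\<lambda>n. (- 1) ^ n * ((- \<bar>a\<bar>) gchoose n) * u ^ n"
  have "(\<lambda>n. ((- \<bar>a\<bar>) gchoose n) * (- u) ^ n) sums (1 + - u) powr (- \<bar>a\<bar>)"
    using assms by (intro gen_binomial_real) auto
  moreover have "((- \<bar>a\<bar>) gchoose n) * (- u) ^ n = ?g n" for n
    by (subst power_minus) (simp only: mult_ac)
  ultimately have g: "?g sums (1 - u) powr (- \<bar>a\<bar>)"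
    by simp
  have le: "\<bar>a gchoose n\<bar> * u ^ n \<le> ?g n" for n
    using assms by (intro mult_right_mono abs_gbinomial_le) auto
  have "0 \<le> ?g n" for n
    by (rule order_trans[OF _ le]) (use assms in auto)
  then have "(\<Sum>n<N. ?g n) \<le> (1 - u) powr (- \<bar>a\<bar>)" for N
    using sum_le_suminf[OF sums_summable[OF g], of "{..<N}"] sums_unique[OF g] by simp
  then show "(\<Sum>n<N. \<bar>a gchoose n\<bar> * u ^ n) \<le> (1 - u) powr (- \<bar>a\<bar>)" for N
    by (rule order_trans[OF sum_mono[OF le]])
  then show "summable (\<lambda>n. \<bar>a gchoose n\<bar> * u ^ n)"
    using assms by (intro summableI_nonneg_bounded) auto
qed

text \<open>One of the two exponentials \<open>exp (s * Y \<omega>)\<close> and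
  \<open>exp (- s * Y \<omega>)\<close> equals \<open>exp (s * \<bar>Y \<omega>\<bar>)\<close>, so
  their sum dominates it.\<close>

lemma integrable_exp_abs:
  assumes "Y \<in> borel_measurable M"
    and "integrable M (\<lambda>\<omega>. exp (s * Y \<omega>))" "integrable M (\<lambda>\<omega>. exp (- s * Y \<omega>))"
  shows "integrable M (\<lambda>\<omega>. exp (s * \<bar>Y \<omega>\<bar>) :: real)"
proof (rule Bochner_Integration.integrable_bound)
  show "integrable M (\<lambda>\<omega>. exp (s * Y \<omega>) + exp (- s * Y \<omega>))"
    using assms by auto
  show "AE \<omega> in M. norm (exp (s * \<bar>Y \<omega>\<bar>)) \<le> norm (exp (s * Y \<omega>) + exp (- s * Y \<omega>))"
    unfolding real_norm_def abs_exp_cancel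
    by (intro AE_I2 order_trans[OF _ abs_ge_self]) (auto simp: abs_if)
qed (use assms(1) in simp)

text \<open>Sum and integral may be exchanged once the integrals of the absolute terms are summable;
  their partial sums are bounded by the integral of the majorant in \<open>int\<close>.\<close>

lemma sums_integral_deg_exp:
  assumes [measurable]: "Y \<in> borel_measurable M" and t: "\<bar>lam * t\<bar> < 1"
    and int: "integrable M (\<lambda>\<omega>. (1 - \<bar>lam * t\<bar>) powr (- \<bar>Y \<omega> / lam\<bar>))"
  shows "(\<lambda>n. (\<integral>\<omega>. (Y \<omega> / lam gchoose n) * lam ^ n \<partial>M) * t ^ n) sums (\<integral>\<omega>. deg_exp lam (Y \<omega>) t \<partial>M)"
    and "integrable M (\<lambda>\<omega>. deg_exp lam (Y \<omega>) t)"
proof -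
  let ?f = "\<lambda>n \<omega>. (Y \<omega> / lam gchoose n) * (lam * t) ^ n"
  have norm_f: "norm (?f n \<omega>) = \<bar>Y \<omega> / lam gchoose n\<bar> * \<bar>lam * t\<bar> ^ n" for n \<omega>
    by (simp add: abs_mult power_abs)
  note bound = sum_abs_gbinomial_le[OF abs_ge_zero t]
  have [measurable]: "?f n \<in> borel_measurable M" for n
    unfolding gbinomial_prod_rev by measurable
  have f_int: "integrable M (?f n)" for n
  proof (rule Bochner_Integration.integrable_bound[OF int])
    show "AE \<omega> in M. norm (?f n \<omega>) \<le> norm ((1 - \<bar>lam * t\<bar>) powr (- \<bar>Y \<omega> / lam\<bar>))"
    proof (intro AE_I2)
      fix \<omega>
      \<comment> \<open>A single term is at most the partial sum of absolute values that contains
        it.\<close>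
      have "norm (?f n \<omega>) \<le> (\<Sum>i<Suc n. \<bar>Y \<omega> / lam gchoose i\<bar> * \<bar>lam * t\<bar> ^ i)"
        unfolding norm_f by (rule member_le_sum) auto
      also have "\<dots> \<le> (1 - \<bar>lam * t\<bar>) powr (- \<bar>Y \<omega> / lam\<bar>)"
        by (rule bound)
      finally show "norm (?f n \<omega>) \<le> norm ((1 - \<bar>lam * t\<bar>) powr (- \<bar>Y \<omega> / lam\<bar>))"
        by simp
    qed
  qed measurable
  have summ: "AE \<omega> in M. summable (\<lambda>n. norm (?f n \<omega>))"
    unfolding norm_f by (intro AE_I2 bound)
  have summ_int: "summable (\<lambda>n. \<integral>\<omega>. norm (?f n \<omega>) \<partial>M)"
  proof (rule summableI_nonneg_bounded)
    fix N
    have "(\<Sum>n<N. \<integral>\<omega>. norm (?f n \<omega>) \<partial>M) = (\<integral>\<omega>. (\<Sum>n<N. norm (?f n \<omega>)) \<partial>M)"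
      using f_int by (subst Bochner_Integration.integral_sum) auto
    also have "\<dots> \<le> (\<integral>\<omega>. (1 - \<bar>lam * t\<bar>) powr (- \<bar>Y \<omega> / lam\<bar>) \<partial>M)"
      using f_int int bound(2)
      by (intro integral_mono Bochner_Integration.integrable_sum integrable_norm)
         (auto simp only: norm_f)
    finally show "(\<Sum>n<N. \<integral>\<omega>. norm (?f n \<omega>) \<partial>M) \<le> (\<integral>\<omega>. (1 - \<bar>lam * t\<bar>) powr (- \<bar>Y \<omega> / lam\<bar>) \<partial>M)" .
  qed simp
  have f_suminf: "(\<Sum>n. ?f n \<omega>) = deg_exp lam (Y \<omega>) t" for \<omega>
    using gen_binomial_real[OF t, of "Y \<omega> / lam"] by (simp add: deg_exp_def sums_iff)
  show "(\<lambda>n. (\<integral>\<omega>. (Y \<omega> / lam gchoose n) * lam ^ n \<partial>M) * t ^ n) sums (\<integral>\<omega>. deg_exp lam (Y \<omega>) t \<partial>M)"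
    using sums_integral[OF f_int summ summ_int, unfolded f_suminf]
    by (simp add: power_mult_distrib mult.assoc)
  show "integrable M (\<lambda>\<omega>. deg_exp lam (Y \<omega>) t)"
    using integrable_suminf[OF f_int summ summ_int] by (simp add: f_suminf)
qed

text \<open>The majorant equals \<open>exp (s * \<bar>Y \<omega>\<bar>)\<close> with
  \<open>s = - ln (1 - \<bar>lam * t\<bar>) / \<bar>lam\<bar>\<close>. As \<open>t\<close> tends to
  0 so does \<open>s\<close>, which thus enters the interval where the moment generating function
  exists.\<close>

lemma eventually_integrable_powr:
  assumes "Y \<in> borel_measurable M" "has_mgf_near_0 M Y" "lam \<noteq> 0"
  shows "\<forall>\<^sub>F t in nhds 0. \<bar>lam * t\<bar> < 1 \<and> integrable M (\<lambda>\<omega>. (1 - \<bar>lam * t\<bar>) powr (- \<bar>Y \<omega> / lam\<bar>))"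
proof -
  obtain e where e: "e > 0" "\<And>s. \<bar>s\<bar> < e \<Longrightarrow> integrable M (\<lambda>\<omega>. exp (s * Y \<omega>))"
    using assms(2) unfolding has_mgf_near_0_def by auto
  have "((\<lambda>t. \<bar>lam * t\<bar>) \<longlongrightarrow> \<bar>lam * 0\<bar>) (nhds 0)"
    by (intro tendsto_intros filterlim_ident)
  then have ev1: "\<forall>\<^sub>F t in nhds 0. \<bar>lam * t\<bar> < 1"
    by (rule order_tendstoD) auto
  have "((\<lambda>t. \<bar>ln (1 - \<bar>lam * t\<bar>) / \<bar>lam\<bar>\<bar>) \<longlongrightarrow> \<bar>ln (1 - \<bar>lam * 0\<bar>) / \<bar>lam\<bar>\<bar>) (nhds 0)"
    by (intro tendsto_intros filterlim_ident) (use assms in auto)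
  then have "\<forall>\<^sub>F t in nhds 0. \<bar>ln (1 - \<bar>lam * t\<bar>) / \<bar>lam\<bar>\<bar> < e"
    by (rule order_tendstoD) (use e in auto)
  with ev1 show ?thesis
  proof eventually_elim
    case (elim t)
    let ?s = "- (ln (1 - \<bar>lam * t\<bar>) / \<bar>lam\<bar>)"
    have "integrable M (\<lambda>\<omega>. exp (?s * \<bar>Y \<omega>\<bar>))"
      using elim(2) by (intro integrable_exp_abs assms e) auto
    moreover have "exp (?s * \<bar>Y \<omega>\<bar>) = (1 - \<bar>lam * t\<bar>) powr (- \<bar>Y \<omega> / lam\<bar>)" for \<omega>
      using elim(1) by (simp add: powr_def abs_divide mult_ac)
    ultimately show ?case
      using elim(1) by simp
  qed
qed

text \<open>The degenerate exponential turns sums in the exponent into products, and expectations of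
  products of independent variables factor.\<close>

lemma (in prob_space) integral_deg_exp_partial_sum:
  assumes Y: "Y \<in> borel_measurable M" and copies: "iid_copies M Y Ys"
    and "\<bar>lam * t\<bar> < 1" "integrable M (\<lambda>\<omega>. deg_exp lam (Y \<omega>) t)"
  shows "(\<integral>\<omega>. deg_exp lam (partial_sum Ys r \<omega>) t \<partial>M) = (\<integral>\<omega>. deg_exp lam (Y \<omega>) t \<partial>M) ^ r"
proof -
  have indep: "indep_vars (\<lambda>_. borel) Ys {1..r}"
    using copies by (auto simp: iid_copies_def intro: indep_vars_subset)
  have [measurable]: "(\<lambda>y. deg_exp lam y t) \<in> borel_measurable borel"
    unfolding deg_exp_def by measurable
  have Ysj: "integrable M (\<lambda>\<omega>. deg_exp lam (Ys j \<omega>) t)"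
      "(\<integral>\<omega>. deg_exp lam (Ys j \<omega>) t \<partial>M) = (\<integral>\<omega>. deg_exp lam (Y \<omega>) t \<partial>M)" if j: "j \<in> {1..r}" for j
  proof -
    have m: "Ys j \<in> borel_measurable M"
      using indep j by (auto simp: indep_vars_def)
    have d: "distr M borel (Ys j) = distr M borel Y"
      using copies j by (auto simp: iid_copies_def)
    \<comment> \<open>Integrability and expectation depend only on the law, which
      \<open>Ys j\<close> shares with \<open>Y\<close>.\<close>
    show "integrable M (\<lambda>\<omega>. deg_exp lam (Ys j \<omega>) t)"
      using assms(4) integrable_distr_eq[OF m, of "\<lambda>y. deg_exp lam y t"]
        integrable_distr_eq[OF Y, of "\<lambda>y. deg_exp lam y t"] d by simp
    show "(\<integral>\<omega>. deg_exp lam (Ys j \<omega>) t \<partial>M) = (\<integral>\<omega>. deg_exp lam (Y \<omega>) t \<partial>M)"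
      using integral_distr[OF m, of "\<lambda>y. deg_exp lam y t"]
        integral_distr[OF Y, of "\<lambda>y. deg_exp lam y t"] d by simp
  qed
  \<comment> \<open>For \<open>r = 0\<close> a zero base would fail: \<open>0 powr 0\<close> is 0,
    while the empty product is 1.\<close>
  have "1 + lam * t > 0"
    using assms(3) by linarith
  then have "deg_exp lam (partial_sum Ys r \<omega>) t = (\<Prod>j=1..r. deg_exp lam (Ys j \<omega>) t)" for \<omega>
    by (simp add: deg_exp_def partial_sum_def sum_divide_distrib powr_sum)
  moreover have "indep_vars (\<lambda>_. borel) (\<lambda>j \<omega>. deg_exp lam (Ys j \<omega>) t) {1..r}"
    by (rule indep_vars_compose2[OF indep]) measurable
  ultimately have "(\<integral>\<omega>. deg_exp lam (partial_sum Ys r \<omega>) t \<partial>M) =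
      (\<Prod>j=1..r. \<integral>\<omega>. deg_exp lam (Ys j \<omega>) t \<partial>M)"
    using indep_vars_lebesgue_integral[OF finite_atLeastAtMost _ Ysj(1)] by simp
  also have "\<dots> = (\<integral>\<omega>. deg_exp lam (Y \<omega>) t \<partial>M) ^ r"
    by (simp add: Ysj(2))
  finally show ?thesis .
qed

section \<open>Falling factorials and binomial expansions\<close>

text \<open>The factor \<open>fact k\<close> will cancel the \<open>1 / fact k\<close> of the
  Stirling numbers, leaving binomial coefficients.\<close>

lemma falling_fact_of_nat: "falling_fact (of_nat m :: real) k = fact k * of_nat (m choose k)"
  unfolding falling_fact_def
  by (simp add: binomial_gbinomial gbinomial_mult_fact lessThan_atLeast0)

lemma poly_falling_fact: "poly (falling_fact p k) x = falling_fact (poly p x) k"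
  by (simp add: falling_fact_def poly_prod)

text \<open>In characteristic 0 the naturals up to the larger degree are already more distinct
  points than either degree.\<close>

lemma poly_eqI_of_nat:
  fixes p q :: "'a::{comm_ring_1, ring_no_zero_divisors, ring_char_0} poly"
  assumes "\<And>m::nat. poly p (of_nat m) = poly q (of_nat m)"
  shows "p = q"
proof (rule poly_eqI_degree[where A = "of_nat ` {..max (degree p) (degree q)}"])
  show "card (of_nat ` {..max (degree p) (degree q)} :: 'a set) > degree p"
       "card (of_nat ` {..max (degree p) (degree q)} :: 'a set) > degree q"
    by (simp_all add: card_image inj_on_def)
qed (use assms in auto)

text \<open>\<open>A\<close> is divisible by the formal variable, hence \<open>A ^ k\<close> by its
  \<open>k\<close>-th power. This supplies the vanishing condition of \<open>egf_coeffs_eq\<close>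
  and truncates sums over \<open>k\<close> at \<open>n\<close>.\<close>

lemma fps_nth_power_mult_eq_0:
  fixes A B :: "'a::comm_ring_1 fps"
  assumes "fps_nth A 0 = 0" "n < k"
  shows "fps_nth (A ^ k * B) n = 0"
  unfolding fps_mult_nth using startsby_zero_power_prefix[OF assms(1)] assms(2)
  by (intro sum.neutral) auto

lemma fps_nth_one_plus_power:
  fixes A B :: "'a::comm_ring_1 fps"
  assumes "fps_nth A 0 = 0"
  shows "fps_nth ((1 + A) ^ m * B) n = (\<Sum>k=0..n. of_nat (m choose k) * fps_nth (A ^ k * B) n)"
proof -
  have "(1 + A) ^ m * B = (\<Sum>k\<le>m. of_nat (m choose k) * (A ^ k * B))"
    by (simp add: binomial_ring[of A 1 m] add.commute sum_distrib_right mult.assoc)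
  then have "fps_nth ((1 + A) ^ m * B) n = (\<Sum>k\<le>m. of_nat (m choose k) * fps_nth (A ^ k * B) n)"
    by (simp add: fps_sum_nth fps_of_nat[symmetric])
  \<comment> \<open>Passing from range \<open>m\<close> to range \<open>n\<close> goes through
    \<open>m + n\<close>: terms beyond \<open>m\<close> have zero binomial coefficient, terms beyond
    \<open>n\<close> have order above \<open>n\<close>.\<close>
  also have "\<dots> = (\<Sum>k\<le>m + n. of_nat (m choose k) * fps_nth (A ^ k * B) n)"
    by (intro sum.mono_neutral_left) (auto simp: binomial_eq_0)
  also have "\<dots> = (\<Sum>k=0..n. of_nat (m choose k) * fps_nth (A ^ k * B) n)"
    by (intro sum.mono_neutral_right) (auto simp: fps_nth_power_mult_eq_0 assms)
  finally show ?thesis .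
qed

theorem theorem2p4:
  fixes M :: "'a measure" and Y :: "'a \<Rightarrow> real" and Ys :: "nat \<Rightarrow> 'a \<Rightarrow> real"
    and lam :: real and n r :: nat
  assumes "prob_space M"
    and "lam \<noteq> 0"
    and "Y \<in> borel_measurable M"
    and "has_mgf_near_0 M Y"
    and "iid_copies M Y Ys"
  shows "(\<Sum>k=0..n. smult (prob_deg_r_Stirling2 M Y Ys lam r (n + r) (k + r))
                       (falling_fact [:0, 1:] k)) =
         (\<Sum>k=0..n. smult (prob_deg_Stirling2 M Y lam n k)
                       (falling_fact ([:0, 1:] + of_nat r) k))"
proof -
  interpret prob_space M by fact
  let ?G = "\<lambda>t. \<integral>\<omega>. deg_exp lam (Y \<omega>) t \<partial>M"
  define A where "A = Abs_fps (\<lambda>n. \<integral>\<omega>. (Y \<omega> / lam gchoose n) * lam ^ n \<partial>M) - 1"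
  note ev = eventually_integrable_powr[OF assms(3,4,2)]
  have "?G has_fps_expansion Abs_fps (\<lambda>n. \<integral>\<omega>. (Y \<omega> / lam gchoose n) * lam ^ n \<partial>M)"
  proof (rule has_fps_expansionI)
    show "\<forall>\<^sub>F t in nhds 0. (\<lambda>n. fps_nth (Abs_fps (\<lambda>n. \<integral>\<omega>. (Y \<omega> / lam gchoose n) * lam ^ n \<partial>M)) n
        * t ^ n) sums ?G t"
      using ev
    proof eventually_elim
      case (elim t)
      then show ?case
        using sums_integral_deg_exp(1)[OF assms(3)] by simp
    qed
  qed
  then have G: "?G has_fps_expansion 1 + A"
    by (simp add: A_def)
  have A: "(\<lambda>t. ?G t - 1) has_fps_expansion A"
    using has_fps_expansion_diff[OF G has_fps_expansion_1] by simp
  \<comment> \<open>The coefficient at index 0 is the expectation of 1, which is 1 for a probability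
    measure and cancels the subtracted 1.\<close>
  have A0: "fps_nth A 0 = 0"
    by (simp add: A_def prob_space)
  note low = fps_nth_power_mult_eq_0[OF A0]
  have S: "(\<lambda>t. \<integral>\<omega>. deg_exp lam (partial_sum Ys r \<omega>) t \<partial>M) has_fps_expansion (1 + A) ^ r"
  proof -
    \<comment> \<open>Agreement near 0 suffices to transfer an expansion.\<close>
    have "\<forall>\<^sub>F t in nhds 0. (\<integral>\<omega>. deg_exp lam (partial_sum Ys r \<omega>) t \<partial>M) = ?G t ^ r"
      using ev by eventually_elim
        (auto intro!: integral_deg_exp_partial_sum sums_integral_deg_exp(2) assms)
    then show ?thesis
      using has_fps_expansion_power[OF G, of r] unfolding has_fps_expansion_def
      by (auto elim: eventually_elim2)
  qed
  have Stirling: "prob_deg_Stirling2 M Y lam n k = fact n / fact k * fps_nth (A ^ k) n" for k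
  proof -
    have "(\<lambda>t. 1 / fact k * (?G t - 1) ^ k) has_fps_expansion fps_const (1 / fact k) * A ^ k"
      by (intro has_fps_expansion_cmult_left has_fps_expansion_power A)
    then show ?thesis
      unfolding prob_deg_Stirling2_def
      by (subst egf_coeffs_eq) (use low[where B = 1] in auto)
  qed
  have r_Stirling: "prob_deg_r_Stirling2 M Y Ys lam r (n + r) (k + r) =
      fact n / fact k * fps_nth (A ^ k * (1 + A) ^ r) n" for k
  proof -
    have "(\<lambda>t. 1 / fact k * (?G t - 1) ^ k * (\<integral>\<omega>. deg_exp lam (partial_sum Ys r \<omega>) t \<partial>M))
        has_fps_expansion fps_const (1 / fact k) * A ^ k * (1 + A) ^ r"
      by (intro has_fps_expansion_mult has_fps_expansion_cmult_left has_fps_expansion_power A S)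
    then show ?thesis
      unfolding prob_deg_r_Stirling2_def add_diff_cancel_right'
      by (subst egf_coeffs_eq) (use low in \<open>auto simp: mult.assoc\<close>)
  qed
  show ?thesis
  proof (rule poly_eqI_of_nat)
    fix m :: nat
    let ?x = "of_nat m :: real"
    have "poly (\<Sum>k=0..n. smult (prob_deg_r_Stirling2 M Y Ys lam r (n + r) (k + r))
        (falling_fact [:0, 1:] k)) ?x
        = fact n * (\<Sum>k=0..n. of_nat (m choose k) * fps_nth (A ^ k * (1 + A) ^ r) n)"
      by (simp add: poly_sum poly_falling_fact falling_fact_of_nat r_Stirling sum_distrib_left mult_ac)
    also have "\<dots> = fact n * fps_nth ((1 + A) ^ (m + r)) n"
      by (simp add: fps_nth_one_plus_power[OF A0] power_add)
    \<comment> \<open>The same coefficient is expanded again, now with full exponent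
      \<open>m + r\<close> and trivial cofactor 1.\<close>
    also have "\<dots> = fact n * (\<Sum>k=0..n. of_nat ((m + r) choose k) * fps_nth (A ^ k) n)"
      using fps_nth_one_plus_power[OF A0, of "m + r" 1 n] by simp
    \<comment> \<open>The shifted argument evaluates to \<open>m + r\<close>, again a natural
      number, so \<open>falling_fact_of_nat\<close> applies.\<close>
    also have "\<dots> = poly (\<Sum>k=0..n. smult (prob_deg_Stirling2 M Y lam n k)
        (falling_fact ([:0, 1:] + of_nat r) k)) ?x"
      by (simp add: poly_sum poly_falling_fact falling_fact_of_nat Stirling sum_distrib_left mult_ac
          flip: of_nat_add)
    finally show "poly (\<Sum>k=0..n. smult (prob_deg_r_Stirling2 M Y Ys lam r (n + r) (k + r))
        (falling_fact [:0, 1:] k)) ?x = poly (\<Sum>k=0..n. smult (prob_deg_Stirling2 M Y lam n k)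
        (falling_fact ([:0, 1:] + of_nat r) k)) ?x" .
  qed
qed

end
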